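(* Let $f(n)$ be a function satisfying $1\leq f(n)<\frac{1}{2}n(n-1)+n$. If $l\,n\log n\leq f(n)<\frac{1}{2}n(n-1)+n$ for some constant $l\in\mathbb{R}^{+}$, then $p=\frac{f(n)+n\log\log n}{n^2}$ is a sharp threshold function for the property $tmc(G(n,p))\geq f(n)$. If $f(n)=o(n\log n)$, then $p=\frac{\log n}{n}$ is a sharp threshold function for the property $tmc(G(n,p))\geq f(n)$.
   Context: All graphs are simple, finite and undirected. A graph is total-colored if all its edges and all its vertices are assigned colors. A path in a total-colored graph is a total monochromatic path if all its edges and all its internal vertices have the same color. A total-coloring is a TMC-coloring if any two vertices are connected by a total monochromatic path. For a connected graph $G$, $tmc(G)$ is the maximum number of colors used in a TMC-coloring of $G$; if $G$ is disconnected, $tmc(G)=0$. $G(n,p)$ is the Erdős–Rényi random graph on $n$ vertices with each edge present independently with probability $p$. $G(n,p)$ satisfies a property $P$ almost surely if the probability that $G(n,p(n))$ satisfies $P$ tends to $1$ as $n\to\infty$. A function $g(n)$ is a sharp threshold function for $P$ if there are positive constants $C$ and $c$ such that $G(n,p)$ almost surely satisfies $P$ for all $p\geq Cg(n)$, and $G(n,cg(n))$ almost surely does not satisfy $P$. *)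

theory Defs
  imports
    "HOL-Probability.Probability"
    "HOL-Library.Ramsey"
    "HOL-Library.Landau_Symbols"
begin

section \<open>Graphs and total monochromatic connection\<close>

text \<open>A graph is a pair of a vertex set and a set of two-element sets of vertices.\<close>

type_synonym 'a graph = "'a set \<times> 'a set set"

abbreviation verts :: "'a graph \<Rightarrow> 'a set" where "verts \<equiv> fst"
abbreviation edges :: "'a graph \<Rightarrow> 'a set set" where "edges \<equiv> snd"

definition simple_graph :: "'a graph \<Rightarrow> bool" where
  "simple_graph G \<longleftrightarrow> finite (verts G) \<and> edges G \<subseteq> [verts G]\<^bsup>2\<^esup>"

definition path_edges :: "'a list \<Rightarrow> 'a set set" where
  "path_edges xs = {{xs ! i, xs ! Suc i} | i. Suc i < length xs}"

definition internal_verts :: "'a list \<Rightarrow> 'a set" where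
  "internal_verts xs = set (butlast (tl xs))"

definition is_path :: "'a graph \<Rightarrow> 'a \<Rightarrow> 'a list \<Rightarrow> 'a \<Rightarrow> bool" where
  "is_path G u xs v \<longleftrightarrow> xs \<noteq> [] \<and> hd xs = u \<and> last xs = v \<and> distinct xs \<and>
     set xs \<subseteq> verts G \<and> path_edges xs \<subseteq> edges G"

definition connected_graph :: "'a graph \<Rightarrow> bool" where
  "connected_graph G \<longleftrightarrow> verts G \<noteq> {} \<and> (\<forall>u\<in>verts G. \<forall>v\<in>verts G. \<exists>xs. is_path G u xs v)"

text \<open>
  A total-coloring consists of a vertex coloring \<open>cv\<close> and an edge coloring \<open>ce\<close> that share one
  palette; it need not be proper. Only the values on \<open>verts G\<close> and \<open>edges G\<close> matter.
\<close>

definition total_monochromatic :: "('a \<Rightarrow> 'c) \<Rightarrow> ('a set \<Rightarrow> 'c) \<Rightarrow> 'a list \<Rightarrow> bool" where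
  "total_monochromatic cv ce xs \<longleftrightarrow>
     (\<exists>c. (\<forall>e\<in>path_edges xs. ce e = c) \<and> (\<forall>w\<in>internal_verts xs. cv w = c))"

definition TMC_coloring :: "'a graph \<Rightarrow> ('a \<Rightarrow> 'c) \<Rightarrow> ('a set \<Rightarrow> 'c) \<Rightarrow> bool" where
  "TMC_coloring G cv ce \<longleftrightarrow>
     (\<forall>u\<in>verts G. \<forall>v\<in>verts G. \<exists>xs. is_path G u xs v \<and> total_monochromatic cv ce xs)"

definition colors_used :: "'a graph \<Rightarrow> ('a \<Rightarrow> 'c) \<Rightarrow> ('a set \<Rightarrow> 'c) \<Rightarrow> 'c set" where
  "colors_used G cv ce = cv ` verts G \<union> ce ` edges G"

definition color_counts :: "'a graph \<Rightarrow> nat set" where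
  "color_counts G = {card (colors_used G cv ce) | cv ce :: _ \<Rightarrow> nat. TMC_coloring G cv ce}"

definition tmc :: "'a graph \<Rightarrow> nat" where
  "tmc G = (if connected_graph G then Max (color_counts G) else 0)"

text \<open>The maximum in \<open>tmc\<close> ranges over a finite nonempty set:\<close>

lemma finite_color_counts:
  assumes "simple_graph G"
  shows "finite (color_counts G)"
proof -
  have V: "finite (verts G)" using assms by (simp add: simple_graph_def)
  have "edges G \<subseteq> Pow (verts G)"
    using assms by (auto simp: simple_graph_def nsets_def)
  then have E: "finite (edges G)" using V by (meson finite_Pow_iff finite_subset)
  have "card (colors_used G cv ce) \<le> card (verts G) + card (edges G)"
    for cv :: "'a \<Rightarrow> nat" and ce
    unfolding colors_used_def
    by (rule order_trans[OF card_Un_le]) (intro add_mono card_image_le V E)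
  then have "color_counts G \<subseteq> {..card (verts G) + card (edges G)}"
    by (auto simp: color_counts_def)
  then show ?thesis by (rule finite_subset) simp
qed

lemma color_counts_nonempty:
  assumes "connected_graph G"
  shows "color_counts G \<noteq> {}"
proof -
  have "total_monochromatic (\<lambda>_. 0 :: nat) (\<lambda>_. 0) xs" for xs :: "'a list"
    unfolding total_monochromatic_def by blast
  then have "TMC_coloring G (\<lambda>_. 0 :: nat) (\<lambda>_. 0)"
    using assms by (simp add: TMC_coloring_def connected_graph_def)
  then show ?thesis by (auto simp: color_counts_def)
qed

section \<open>The random graph and sharp thresholds\<close>

text \<open>
  Each pair from \<open>{..<n}\<close> is an edge independently with probability \<open>p\<close>. Since \<open>bernoulli_pmf\<close>
  clamps its parameter to the unit interval, \<open>p \<ge> 1\<close> gives the complete graph.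
\<close>

definition gnp :: "nat \<Rightarrow> real \<Rightarrow> nat graph pmf" where
  "gnp n p = map_pmf (\<lambda>b. ({..<n}, {e \<in> [{..<n}]\<^bsup>2\<^esup>. b e}))
     (Pi_pmf ([{..<n}]\<^bsup>2\<^esup>) False (\<lambda>_. bernoulli_pmf p))"

lemma simple_graph_gnp: "G \<in> set_pmf (gnp n p) \<Longrightarrow> simple_graph G"
  by (auto simp: gnp_def simple_graph_def)

definition almost_surely_gnp :: "(nat \<Rightarrow> real) \<Rightarrow> (nat \<Rightarrow> nat graph \<Rightarrow> bool) \<Rightarrow> bool" where
  "almost_surely_gnp p P \<longleftrightarrow>
     (\<lambda>n. measure_pmf.prob (gnp n (p n)) {G. P n G}) \<longlonglongrightarrow> 1"

text \<open>
  The function \<open>p\<close> is not required to stay below 1, because of the clamping in \<open>gnp\<close>: where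
  \<open>C * g n > 1\<close>, the condition \<open>p n \<ge> C * g n\<close> thus says that the edge probability is 1, and the
  first clause is not vacuous when \<open>g\<close> is bounded away from 0.
\<close>

definition sharp_threshold :: "(nat \<Rightarrow> real) \<Rightarrow> (nat \<Rightarrow> nat graph \<Rightarrow> bool) \<Rightarrow> bool" where
  "sharp_threshold g P \<longleftrightarrow>
     (\<exists>C c. C > 0 \<and> c > 0 \<and>
        (\<forall>p. (\<forall>\<^sub>F n in sequentially. p n \<ge> C * g n) \<longrightarrow> almost_surely_gnp p P) \<and>
        almost_surely_gnp (\<lambda>n. c * g n) (\<lambda>n G. \<not> P n G))"

end

theory Submission
  imports Defs "HOL-Real_Asymp.Real_Asymp"
begin

text \<open>
  If every cut of \<open>G\<close> is crossed by an edge, then giving one color to a spanning tree and to all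
  vertices, and a color of its own to each other edge, shows that \<open>tmc G\<close> is at least the number
  of edges minus \<open>n - 1\<close>; trivially, \<open>tmc G\<close> is at most the number of edges plus \<open>n\<close>. The edge
  number of the random graph is concentrated
  around \<open>p * n\<^sup>2 / 2\<close> (exponential Markov inequality), so as soon as \<open>f\<close> dominates \<open>n\<close> and the
  graph is connected, \<open>tmc\<close> reaches \<open>f\<close> when \<open>p\<close> is a large multiple of \<open>f / n\<^sup>2\<close> and not when it
  is a small one. For \<open>p \<ge> 1\<close> the graph is complete and all its elements may get distinct colors,
  which covers the largest \<open>f\<close>. If \<open>f\<close> is of smaller order than \<open>n * ln n\<close>, connectedness, with
  threshold \<open>ln n / n\<close>, is what decides, because a disconnected graph has \<open>tmc = 0\<close>.
\<close>

section \<open>Bounds on tmc\<close>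

lemma tmc_ge_card_colors:
  fixes cv :: "'a \<Rightarrow> nat"
  assumes "simple_graph G" "verts G \<noteq> {}" "TMC_coloring G cv ce"
  shows "card (colors_used G cv ce) \<le> tmc G"
proof -
  have "connected_graph G"
    using assms(2,3) by (auto simp: connected_graph_def TMC_coloring_def)
  moreover have "card (colors_used G cv ce) \<in> color_counts G"
    using assms(3) by (auto simp: color_counts_def)
  ultimately show ?thesis
    using finite_color_counts[OF assms(1)] by (simp add: tmc_def)
qed

lemma finite_edges: "simple_graph G \<Longrightarrow> finite (edges G)"
  by (meson finite_imp_finite_nsets finite_subset simple_graph_def)

lemma tmc_le_card_verts_edges:
  assumes "simple_graph G"
  shows "tmc G \<le> card (verts G) + card (edges G)"
proof (cases "connected_graph G")
  case True
  have "c \<le> card (verts G) + card (edges G)" if c: "c \<in> color_counts G" for c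
  proof -
    obtain cv :: "'a \<Rightarrow> nat" and ce where "c = card (colors_used G cv ce)"
      using c by (auto simp: color_counts_def)
    also have "\<dots> \<le> card (cv ` verts G) + card (ce ` edges G)"
      unfolding colors_used_def by (rule card_Un_le)
    also have "\<dots> \<le> card (verts G) + card (edges G)"
      using assms finite_edges[OF assms]
      by (intro add_mono card_image_le) (auto simp: simple_graph_def)
    finally show ?thesis .
  qed
  then show ?thesis
    using True finite_color_counts[OF assms] color_counts_nonempty[OF True]
    by (simp add: tmc_def)
qed (simp add: tmc_def)

text \<open>Two vertices of a complete graph are joined by a path of at most one edge. Such a path
  has no internal vertex, so every coloring qualifies, even one with all colors distinct.\<close>

lemma tmc_complete_ge:
  assumes "finite V" "V \<noteq> {}"
  shows "card V + (card V choose 2) \<le> tmc (V, [V]\<^bsup>2\<^esup>)"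
proof -
  let ?G = "(V, [V]\<^bsup>2\<^esup>)"
  obtain h :: "'a \<Rightarrow> nat" where h: "inj_on h V"
    using finite_imp_inj_to_nat_seg[OF assms(1)] by blast
  obtain g :: "'a set \<Rightarrow> nat" where g: "inj_on g ([V]\<^bsup>2\<^esup>)"
    using finite_imp_inj_to_nat_seg[OF finite_imp_finite_nsets[OF assms(1)]] by blast
  \<comment> \<open>Even values for vertices and odd ones for edges keep the two palettes
    disjoint.\<close>
  define cv where "cv v = 2 * h v" for v
  define ce where "ce e = 2 * g e + 1" for e
  have "\<exists>xs. is_path ?G u xs v \<and> total_monochromatic cv ce xs"
    if "u \<in> V" "v \<in> V" for u v
  proof (cases "u = v")
    case True
    then show ?thesis
      using that by (intro exI[of _ "[u]"])
        (auto simp: is_path_def path_edges_def total_monochromatic_def internal_verts_def)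
  next
    case False
    have "path_edges [u, v] = {{u, v}}"
      by (auto simp: path_edges_def less_Suc_eq)
    then show ?thesis
      using that False by (intro exI[of _ "[u, v]"])
        (auto simp: is_path_def total_monochromatic_def internal_verts_def)
  qed
  then have "TMC_coloring ?G cv ce"
    by (auto simp: TMC_coloring_def)
  then have "card (colors_used ?G cv ce) \<le> tmc ?G"
    using assms by (intro tmc_ge_card_colors) (auto simp: simple_graph_def)
  moreover have "card (colors_used ?G cv ce) = card V + (card V choose 2)"
  proof -
    have "cv ` V \<inter> ce ` [V]\<^bsup>2\<^esup> = {}"
      by (auto simp: cv_def ce_def) presburger
    then have "card (colors_used ?G cv ce) = card (cv ` V) + card (ce ` [V]\<^bsup>2\<^esup>)"
      using assms by (simp add: colors_used_def card_Un_disjoint finite_imp_finite_nsets)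
    also have "card (cv ` V) = card V"
      using h by (intro card_image) (auto simp: inj_on_def cv_def)
    also have "card (ce ` [V]\<^bsup>2\<^esup>) = card ([V]\<^bsup>2\<^esup>)"
      using g by (intro card_image) (auto simp: inj_on_def ce_def)
    finally show ?thesis by simp
  qed
  ultimately show ?thesis by simp
qed

section \<open>Paths, growing trees and the coloring along a spanning tree\<close>

lemma path_edges_Cons:
  assumes "xs \<noteq> []"
  shows "path_edges (w # xs) = insert {w, hd xs} (path_edges xs)"
proof -
  have "{w, hd xs} \<in> path_edges (w # xs)"
    using assms by (auto simp: path_edges_def hd_conv_nth intro!: exI[of _ 0])
  moreover have "{xs ! i, xs ! Suc i} \<in> path_edges (w # xs)" if "Suc i < length xs" for i
    using that by (auto simp: path_edges_def intro!: exI[of _ "Suc i"])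
  moreover have "{(w # xs) ! i, (w # xs) ! Suc i} \<in> insert {w, hd xs} (path_edges xs)"
    if "Suc i < length (w # xs)" for i
    using that assms by (cases i) (auto simp: path_edges_def hd_conv_nth)
  ultimately show ?thesis
    unfolding path_edges_def by blast
qed

lemma path_edges_rev: "path_edges (rev xs) = path_edges xs"
proof -
  have "path_edges (rev xs) \<subseteq> path_edges xs" for xs :: "'a list"
  proof
    fix e assume "e \<in> path_edges (rev xs)"
    then obtain i where i: "Suc i < length xs" "e = {rev xs ! i, rev xs ! Suc i}"
      by (auto simp: path_edges_def)
    \<comment> \<open>Reversal sends the edge at position \<open>i\<close> to position
      \<open>j\<close> with its ends swapped. The converse inclusion comes from applying this to
      \<open>rev xs\<close>.\<close>
    define j where "j = length xs - Suc (Suc i)"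
    have "rev xs ! Suc i = xs ! j" "rev xs ! i = xs ! Suc j" "Suc j < length xs"
      using i(1) by (auto simp: rev_nth j_def Suc_diff_Suc)
    then show "e \<in> path_edges xs"
      using i(2) by (auto simp: path_edges_def insert_commute)
  qed
  from this[of xs] this[of "rev xs"] show ?thesis by simp
qed

lemma is_path_rev: "is_path G u xs v \<Longrightarrow> is_path G v (rev xs) u"
  by (simp add: is_path_def path_edges_rev hd_rev last_rev)

lemma is_path_mono:
  "is_path G u xs v \<Longrightarrow> verts G \<subseteq> verts H \<Longrightarrow> edges G \<subseteq> edges H \<Longrightarrow> is_path H u xs v"
  by (auto simp: is_path_def)

lemma is_path_Cons:
  assumes "is_path (S, T) s xs v" "w \<notin> S"
  shows "is_path (insert w S, insert {w, s} T) w (w # xs) v"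
  using assms by (auto simp: is_path_def path_edges_Cons)

text \<open>Paths from \<open>w\<close> take the new edge and continue from \<open>s\<close> inside
  \<open>S\<close>; they stay simple because \<open>w\<close> is fresh. Paths to \<open>w\<close>
  are their reversals.\<close>

lemma connected_graph_add_leaf:
  assumes "connected_graph (S, T)" "s \<in> S" "w \<notin> S"
  shows "connected_graph (insert w S, insert {w, s} T)"
proof -
  let ?H = "(insert w S, insert {w, s} T)"
  have from_w: "\<exists>xs. is_path ?H w xs v" if "v \<in> S" for v
    using assms that is_path_Cons unfolding connected_graph_def
    by (metis fst_conv)
  have "\<exists>xs. is_path ?H u xs v" if "u \<in> insert w S" "v \<in> insert w S" for u v
  proof -
    from that consider "u = w" "v = w" | "u = w" "v \<in> S" | "u \<in> S" "v = w" | "u \<in> S" "v \<in> S"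
      by blast
    then show ?thesis
    proof cases
      case 1
      then show ?thesis
        by (intro exI[of _ "[w]"]) (auto simp: is_path_def path_edges_def)
    next
      case 2
      then show ?thesis using from_w by simp
    next
      case 3
      then obtain xs where "is_path ?H w xs u" using from_w by auto
      then have "is_path ?H u (rev xs) w" by (rule is_path_rev)
      with 3 show ?thesis by auto
    next
      case 4
      with assms(1) have "\<exists>xs. is_path (S, T) u xs v"
        unfolding connected_graph_def fst_conv by blast
      then obtain xs where "is_path (S, T) u xs v" ..
      then have "is_path ?H u xs v"
        by (rule is_path_mono) auto
      then show ?thesis ..
    qed
  qed
  then show ?thesis by (simp add: connected_graph_def)
qed

text \<open>Connectedness phrased by cuts: its failure suits a union bound over vertex sets, and a
  crossing edge is just what a growing tree needs.\<close>

definition every_cut_crossed :: "'a graph \<Rightarrow> bool" where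
  "every_cut_crossed G \<longleftrightarrow>
     (\<forall>S. S \<noteq> {} \<longrightarrow> S \<subset> verts G \<longrightarrow> (\<exists>s\<in>S. \<exists>w\<in>verts G - S. {s, w} \<in> edges G))"

lemma spanning_tree_exists:
  assumes "finite (verts G)" "verts G \<noteq> {}" "every_cut_crossed G"
  shows "\<exists>T\<subseteq>edges G. finite T \<and> connected_graph (verts G, T) \<and> card T < card (verts G)"
proof -
  \<comment> \<open>The tree grows from one vertex, each crossing edge adding a leaf;
    \<open>k\<close> counts the added leaves.\<close>
  have "\<exists>S T. S \<subseteq> verts G \<and> card S = Suc k \<and> T \<subseteq> edges G \<and> finite T \<and> card T \<le> k \<and>
          connected_graph (S, T)" if "k < card (verts G)" for k
    using that
  proof (induction k)
    case 0
    obtain r where r: "r \<in> verts G" using assms(2) by blast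
    have "is_path ({r}, {}) r [r] r" by (simp add: is_path_def path_edges_def)
    then have "connected_graph ({r}, {})"
      by (auto simp: connected_graph_def)
    with r show ?case by (intro exI[of _ "{r}"] exI[of _ "{}"]) simp
  next
    case (Suc k)
    then obtain S T where ST: "S \<subseteq> verts G" "card S = Suc k" "T \<subseteq> edges G" "finite T"
      "card T \<le> k" "connected_graph (S, T)" by auto
    then have "S \<noteq> {}" "S \<subset> verts G" using Suc.prems by auto
    then obtain s w where sw: "s \<in> S" "w \<in> verts G" "w \<notin> S" "{w, s} \<in> edges G"
      using assms(3) unfolding every_cut_crossed_def by (metis Diff_iff insert_commute)
    have "finite S" using ST(2) card_ge_0_finite by force
    then have "card (insert w S) = Suc (Suc k)" using ST(2) sw(3) by simp
    moreover have "card (insert {w, s} T) \<le> Suc k"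
      using ST(5) card_insert_le_m1[of "Suc k" T] by simp
    moreover have "connected_graph (insert w S, insert {w, s} T)"
      using connected_graph_add_leaf ST(6) sw by metis
    ultimately show ?case
      using ST sw by (intro exI[of _ "insert w S"] exI[of _ "insert {w, s} T"]) auto
  qed
  moreover have "0 < card (verts G)"
    using assms(1,2) by (simp add: card_gt_0_iff)
  moreover from this obtain k where k: "card (verts G) = Suc k"
    using gr0_implies_Suc by blast
  ultimately obtain S T where ST: "S \<subseteq> verts G"
    "card S = card (verts G)" "T \<subseteq> edges G" "finite T" "card T \<le> k"
    "connected_graph (S, T)"
    by (metis lessI)
  then have "S = verts G" using card_subset_eq assms(1) by blast
  with ST k show ?thesis by (intro exI[of _ T]) simp
qed

lemma card_edges_less_tmc_plus_verts:
  assumes "simple_graph G" "verts G \<noteq> {}" "every_cut_crossed G"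
  shows "card (edges G) < tmc G + card (verts G)"
proof -
  have fin: "finite (verts G)" "finite (edges G)"
    using assms(1) finite_edges[OF assms(1)] by (auto simp: simple_graph_def)
  obtain T where T: "T \<subseteq> edges G" "finite T" "connected_graph (verts G, T)"
    "card T < card (verts G)"
    using spanning_tree_exists[OF fin(1) assms(2,3)] by blast
  obtain g :: "'a set \<Rightarrow> nat" where g: "inj_on g (edges G)"
    using finite_imp_inj_to_nat_seg[OF fin(2)] by blast
  define cv where "cv = (\<lambda>_ :: 'a. 0 :: nat)"
  define ce where "ce e = (if e \<in> T then 0 else Suc (g e))" for e
  have "\<exists>xs. is_path G u xs v \<and> total_monochromatic cv ce xs"
    if "u \<in> verts G" "v \<in> verts G" for u v
  proof -
    obtain xs where xs: "is_path (verts G, T) u xs v"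
      using T(3) \<open>u \<in> verts G\<close> \<open>v \<in> verts G\<close> by (auto simp: connected_graph_def)
    then have "total_monochromatic cv ce xs"
      unfolding total_monochromatic_def is_path_def
      by (intro exI[of _ 0]) (auto simp: cv_def ce_def)
    moreover have "is_path G u xs v"
      using xs by (rule is_path_mono) (use T(1) in auto)
    ultimately show ?thesis by blast
  qed
  then have "TMC_coloring G cv ce"
    by (simp add: TMC_coloring_def)
  then have "card (colors_used G cv ce) \<le> tmc G"
    using tmc_ge_card_colors assms(1,2) by blast
  \<comment> \<open>Only the private colors of the edges outside \<open>T\<close> are counted;
    \<open>card T < card (verts G)\<close> then makes the final inequality strict.\<close>
  moreover have "card (edges G - T) = card (ce ` (edges G - T))"
    using g by (intro card_image[symmetric]) (auto simp: inj_on_def ce_def)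
  moreover have "card (ce ` (edges G - T)) \<le> card (colors_used G cv ce)"
    using fin by (intro card_mono) (auto simp: colors_used_def)
  moreover have "card (edges G - T) = card (edges G) - card T"
    using T(1,2) by (simp add: card_Diff_subset)
  ultimately show ?thesis using T(4) by linarith
qed

text \<open>A path from \<open>v\<close> to another vertex begins with an edge containing
  \<open>v\<close>.\<close>

lemma not_connected_if_isolated:
  assumes "v \<in> verts G" "u \<in> verts G" "u \<noteq> v" "\<And>e. e \<in> edges G \<Longrightarrow> v \<notin> e"
  shows "\<not> connected_graph G"
proof
  assume "connected_graph G"
  then obtain xs where xs: "is_path G v xs u"
    using assms(1,2) by (auto simp: connected_graph_def)
  then obtain ys where ys: "xs = v # ys" "ys \<noteq> []"
    using assms(3) by (cases xs) (auto simp: is_path_def split: if_splits)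
  then have "{v, hd ys} \<in> edges G"
    using xs by (auto simp: is_path_def path_edges_Cons)
  then show False using assms(4) by blast
qed

section \<open>Edge statistics of the random graph\<close>

text \<open>The clamping of \<open>bernoulli_pmf\<close> enters here: every coin is constantly
  \<open>True\<close>, so the distribution is a point mass.\<close>

lemma gnp_ge_1_complete:
  assumes "p \<ge> 1" "G \<in> set_pmf (gnp n p)"
  shows "G = ({..<n}, [{..<n}]\<^bsup>2\<^esup>)"
proof -
  let ?K = "[{..<n}]\<^bsup>2\<^esup>"
  have "pmf (bernoulli_pmf p) False = 0"
    using assms(1) by (simp add: bernoulli_pmf.rep_eq)
  then have "set_pmf (bernoulli_pmf p) \<subseteq> {True}"
    by (auto simp: set_pmf_iff) (metis (full_types))
  then have "bernoulli_pmf p = return_pmf True"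
    by (simp add: set_pmf_subset_singleton)
  then have "gnp n p = return_pmf ({..<n}, {e \<in> ?K. e \<in> ?K})"
    by (simp add: gnp_def finite_imp_finite_nsets Collect_conj_eq)
  then show ?thesis using assms(2) by simp
qed

lemma verts_gnp: "G \<in> set_pmf (gnp n p) \<Longrightarrow> verts G = {..<n}"
  by (auto simp: gnp_def)

lemma finite_set_pmf_gnp: "finite (set_pmf (gnp n p))"
proof (rule finite_subset)
  show "set_pmf (gnp n p) \<subseteq> {{..<n}} \<times> Pow ([{..<n}]\<^bsup>2\<^esup>)"
    by (auto simp: gnp_def)
qed (simp add: finite_imp_finite_nsets)

lemma integrable_gnp [simp]: "integrable (measure_pmf (gnp n p)) (X :: _ \<Rightarrow> real)"
  by (rule integrable_measure_pmf_finite[OF finite_set_pmf_gnp])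

lemma prob_gnp_avoid:
  assumes "0 \<le> p" "p \<le> 1" "S \<subseteq> [{..<n}]\<^bsup>2\<^esup>"
  shows "measure_pmf.prob (gnp n p) {G. edges G \<inter> S = {}} = (1 - p) ^ card S"
proof -
  let ?K = "[{..<n}]\<^bsup>2\<^esup>"
  \<comment> \<open>The event is a box: coins in \<open>S\<close> are forced to be
    \<open>False\<close>, the others are free.\<close>
  let ?B = "\<lambda>e. if e \<in> S then {False} else UNIV"
  have fin: "finite ?K" by (simp add: finite_imp_finite_nsets)
  have "(\<lambda>b. ({..<n}, {e \<in> ?K. b e})) -` {G. edges G \<inter> S = {}} = Pi ?K ?B"
    using assms(3) by (auto simp: Pi_def split: if_splits)
  then have "measure_pmf.prob (gnp n p) {G. edges G \<inter> S = {}} =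
      measure_pmf.prob (Pi_pmf ?K False (\<lambda>_. bernoulli_pmf p)) (Pi ?K ?B)"
    by (simp add: gnp_def)
  also have "\<dots> = (\<Prod>e\<in>?K. measure_pmf.prob (bernoulli_pmf p) (?B e))"
    by (rule measure_Pi_pmf_Pi[OF fin])
  also have "\<dots> = (\<Prod>e\<in>?K. if e \<in> S then 1 - p else 1)"
    using assms(1,2) by (intro prod.cong) (auto simp: measure_pmf_single)
  also have "\<dots> = (1 - p) ^ card S"
    using fin assms(3) by (simp add: prod.If_cases Int_absorb1)
  finally show ?thesis .
qed

section \<open>Exponential moments and tails of the number of edges\<close>

lemma expectation_power_card_edges:
  assumes "0 \<le> p" "p \<le> 1" "(z :: real) \<ge> 0"
  shows "measure_pmf.expectation (gnp n p) (\<lambda>G. z ^ card (edges G)) =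
    (1 - p + p * z) ^ (n choose 2)"
proof -
  let ?K = "[{..<n}]\<^bsup>2\<^esup>"
  have fin: "finite ?K" by (simp add: finite_imp_finite_nsets)
  have "z ^ card {e \<in> ?K. b e} = (\<Prod>e\<in>?K. if b e then z else 1)" for b
    using fin by (simp add: prod.If_cases Int_def)
  then have "measure_pmf.expectation (gnp n p) (\<lambda>G. z ^ card (edges G)) =
      measure_pmf.expectation (Pi_pmf ?K False (\<lambda>_. bernoulli_pmf p))
        (\<lambda>b. \<Prod>e\<in>?K. if b e then z else 1)"
    by (simp add: gnp_def)
  also have "\<dots> = (\<Prod>e\<in>?K. measure_pmf.expectation (bernoulli_pmf p) (\<lambda>c. if c then z else 1))"
    using assms fin
    by (intro expectation_prod_Pi_pmf) (auto intro!: integrable_measure_pmf_finite)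
  also have "\<dots> = (1 - p + p * z) ^ (n choose 2)"
    using assms by (simp add: algebra_simps)
  finally show ?thesis .
qed

lemma expectation_power_card_edges_le:
  assumes "0 \<le> p" "p \<le> 1" "(z :: real) \<ge> 0"
  shows "measure_pmf.expectation (gnp n p) (\<lambda>G. z ^ card (edges G)) \<le>
    exp (real (n choose 2) * p * (z - 1))"
proof -
  have "1 - p + p * z \<le> exp (p * (z - 1))"
    using exp_ge_add_one_self[of "p * (z - 1)"] by (simp add: algebra_simps)
  moreover have "0 \<le> 1 - p + p * z"
    using assms by simp
  ultimately have "(1 - p + p * z) ^ (n choose 2) \<le> exp (p * (z - 1)) ^ (n choose 2)"
    by (intro power_mono)
  then show ?thesis
    using assms by (simp add: expectation_power_card_edges exp_of_nat_mult[symmetric] mult.assoc)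
qed

text \<open>Markov's inequality for \<open>2 ^ card (edges G)\<close>; the bound ln 2 \<ge> 2/3 is
  weakened to 1/2.\<close>

lemma prob_card_edges_ge:
  assumes "0 \<le> p" "p \<le> 1" "a \<ge> 0"
  shows "measure_pmf.prob (gnp n p) {G. real (card (edges G)) \<ge> a} \<le>
    exp (real (n choose 2) * p - a / 2)"
proof -
  let ?E = "measure_pmf.expectation (gnp n p) (\<lambda>G. 2 ^ card (edges G) :: real)"
  have "(2 powr a \<le> 2 ^ m) \<longleftrightarrow> a \<le> real m" for m
    by (subst powr_realpow[symmetric]) auto
  then have "measure_pmf.prob (gnp n p) {G. real (card (edges G)) \<ge> a} \<le> ?E / 2 powr a"
    using integral_Markov_inequality_measure[of "gnp n p" "\<lambda>G. 2 ^ card (edges G)" "{}" "2 powr a"]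
    by simp
  also have "\<dots> \<le> exp (real (n choose 2) * p) / exp (a * ln 2)"
    using expectation_power_card_edges_le[OF assms(1,2), of 2 n]
    by (simp add: powr_def divide_right_mono)
  also have "\<dots> \<le> exp (real (n choose 2) * p - a / 2)"
    using mult_left_mono[OF ln2_ge_two_thirds assms(3)] assms(3)
    by (simp add: exp_diff[symmetric])
  finally show ?thesis .
qed

text \<open>Markov's inequality for \<open>(1 / 2) ^ card (edges G)\<close>, which is large when
  edges are few; the bound ln 2 \<le> 25/36 is rounded up to 3/4.\<close>

lemma prob_card_edges_le:
  assumes "0 \<le> p" "p \<le> 1" "a \<ge> 0"
  shows "measure_pmf.prob (gnp n p) {G. real (card (edges G)) \<le> a} \<le>
    exp (3 / 4 * a - real (n choose 2) * p / 2)"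
proof -
  let ?E = "measure_pmf.expectation (gnp n p) (\<lambda>G. (1 / 2) ^ card (edges G) :: real)"
  have "((1 / 2) powr a \<le> (1 / 2) ^ m) \<longleftrightarrow> real m \<le> a" for m
    by (subst powr_realpow[symmetric]) (auto simp: powr_def ln_div)
  then have "measure_pmf.prob (gnp n p) {G. real (card (edges G)) \<le> a} \<le> ?E / (1 / 2) powr a"
    using integral_Markov_inequality_measure[of "gnp n p" "\<lambda>G. (1 / 2) ^ card (edges G)" "{}"
        "(1 / 2) powr a"]
    by simp
  also have "\<dots> \<le> exp (- (real (n choose 2) * p / 2)) / exp (- (a * ln 2))"
    using expectation_power_card_edges_le[OF assms(1,2), of "1 / 2" n]
    by (simp add: powr_def ln_div divide_right_mono)
  also have "\<dots> \<le> exp (3 / 4 * a - real (n choose 2) * p / 2)"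
    using mult_left_mono[OF ln2_le_25_over_36 assms(3)] assms(3)
    by (simp add: exp_diff[symmetric])
  finally show ?thesis .
qed

section \<open>Connectedness of the random graph\<close>

definition cut_edges :: "'a set \<Rightarrow> 'a set \<Rightarrow> 'a set set" where
  "cut_edges V S = (\<lambda>(s, w). {s, w}) ` (S \<times> (V - S))"

lemma card_cut_edges:
  assumes "finite V" "S \<subseteq> V"
  shows "card (cut_edges V S) = card S * (card V - card S)"
proof -
  \<comment> \<open>Only one end of a cut edge lies in \<open>S\<close>, so the ordered pair can be
    recovered.\<close>
  have "inj_on (\<lambda>(s, w). {s, w}) (S \<times> (V - S))"
    by (auto simp: inj_on_def doubleton_eq_iff)
  then show ?thesis
    using assms by (simp add: cut_edges_def card_image card_cartesian_product card_Diff_subset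
        finite_subset)
qed

lemma cut_edges_subset: "S \<subseteq> V \<Longrightarrow> cut_edges V S \<subseteq> [V]\<^bsup>2\<^esup>"
  by (auto simp: cut_edges_def)

text \<open>A set and its complement define the same cut, so the smaller side may represent it. The
  other side then has at least half of the vertices, which the union bound uses.\<close>

lemma every_cut_crossed_small_cuts:
  assumes "finite (verts G)"
    "\<And>S. S \<subseteq> verts G \<Longrightarrow> S \<noteq> {} \<Longrightarrow> 2 * card S \<le> card (verts G) \<Longrightarrow>
      edges G \<inter> cut_edges (verts G) S \<noteq> {}"
  shows "every_cut_crossed G"
  unfolding every_cut_crossed_def
proof (intro allI impI)
  fix S assume S: "S \<noteq> {}" "S \<subset> verts G"
  have "card S + card (verts G - S) = card (verts G)"
    using S assms(1) by (metis card_Diff_subset card_mono finite_subset le_add_diff_inverse psubset_imp_subset)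
  then consider "2 * card S \<le> card (verts G)" | "2 * card (verts G - S) \<le> card (verts G)"
    by linarith
  then show "\<exists>s\<in>S. \<exists>w\<in>verts G - S. {s, w} \<in> edges G"
  proof cases
    case 1
    then have "edges G \<inter> cut_edges (verts G) S \<noteq> {}"
      using S by (intro assms(2)) auto
    then show ?thesis by (auto simp: cut_edges_def)
  next
    case 2
    then have "edges G \<inter> cut_edges (verts G) (verts G - S) \<noteq> {}"
      using S by (intro assms(2)) auto
    then obtain w s where "w \<in> verts G - S" "s \<in> verts G - (verts G - S)" "{w, s} \<in> edges G"
      by (auto simp: cut_edges_def)
    then show ?thesis by (metis Diff_iff insert_commute)
  qed
qed

text \<open>A union bound over the smaller sides \<open>S\<close> of all cuts, with the cut at \<open>S\<close> uncrossed with
  probability at most \<open>q ^ card S\<close>, where \<open>q = exp (- p * n / 2)\<close>.\<close>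

lemma prob_not_every_cut_crossed:
  assumes "0 \<le> p" "p \<le> 1"
  shows "measure_pmf.prob (gnp n p) {G. \<not> every_cut_crossed G} \<le>
    (1 + exp (- p * real n / 2)) ^ n - 1"
proof -
  let ?V = "{..<n}"
  define q where "q = exp (- p * real n / 2)"
  define \<S> where "\<S> = {S. S \<subseteq> ?V \<and> S \<noteq> {} \<and> 2 * card S \<le> n}"
  have fin: "finite \<S>" by (rule finite_subset[of _ "Pow ?V"]) (auto simp: \<S>_def)
  let ?A = "\<lambda>S. {G :: nat graph. edges G \<inter> cut_edges ?V S = {}}"
  have "measure_pmf.prob (gnp n p) {G. \<not> every_cut_crossed G} \<le>
      measure_pmf.prob (gnp n p) (\<Union>S\<in>\<S>. ?A S)"
  proof (intro measure_pmf.finite_measure_mono_AE AE_pmfI impI)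
    fix G assume G: "G \<in> set_pmf (gnp n p)" "G \<in> {G. \<not> every_cut_crossed G}"
    then show "G \<in> (\<Union>S\<in>\<S>. ?A S)"
      using every_cut_crossed_small_cuts[of G] by (auto simp: verts_gnp[OF G(1)] \<S>_def)
  qed simp
  also have "\<dots> \<le> (\<Sum>S\<in>\<S>. measure_pmf.prob (gnp n p) (?A S))"
    using fin by (intro measure_UNION_le) auto
  also have "\<dots> \<le> (\<Sum>S\<in>\<S>. q ^ card S)"
  proof (rule sum_mono)
    fix S assume "S \<in> \<S>"
    then have S: "S \<subseteq> ?V" "2 * card S \<le> n" by (auto simp: \<S>_def)
    define k where "k = card S"
    \<comment> \<open>As \<open>S\<close> is the smaller side, its cut consists of at least
      \<open>k * n / 2\<close> pairs.\<close>
    have "real n / 2 \<le> real (n - k)"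
      using S(2) by (simp add: k_def)
    then have "p * (real n / 2) * real k \<le> p * real (n - k) * real k"
      using assms(1) by (intro mult_right_mono mult_left_mono) auto
    then have *: "- p * real (k * (n - k)) \<le> real k * (- p * real n / 2)"
      by (simp add: field_simps del: of_nat_diff)
    have "measure_pmf.prob (gnp n p) (?A S) = (1 - p) ^ (k * (n - k))"
      using prob_gnp_avoid[OF assms cut_edges_subset[OF S(1)]] card_cut_edges[OF _ S(1)]
      by (simp add: k_def)
    also have "\<dots> \<le> exp (- p) ^ (k * (n - k))"
      using assms exp_ge_add_one_self[of "- p"] by (intro power_mono) auto
    also have "\<dots> = exp (- p * real (k * (n - k)))"
      by (simp only: exp_of_nat2_mult)
    also have "\<dots> \<le> q ^ k"
      unfolding q_def exp_of_nat_mult[symmetric] using * by simp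
    finally show "measure_pmf.prob (gnp n p) (?A S) \<le> q ^ card S"
      by (simp add: k_def)
  qed
  \<comment> \<open>Admitting the larger sets adds only nonnegative terms and completes the sum to a
    binomial expansion without its term 1 for the empty set.\<close>
  also have "\<dots> \<le> (\<Sum>S\<in>Pow ?V - {{}}. q ^ card S)"
    by (intro sum_mono2) (auto simp: \<S>_def q_def)
  also have "\<dots> = (\<Sum>S\<in>Pow ?V. q ^ card S) - 1"
    by (simp add: sum_diff1)
  also have "(\<Sum>S\<in>Pow ?V. q ^ card S) = (1 + q) ^ n"
    using prod_add[of ?V "\<lambda>_. q" "\<lambda>_. 1"] by (simp add: add.commute)
  finally show ?thesis by (simp add: q_def)
qed

section \<open>Isolated vertices\<close>

definition star_edges :: "'a set \<Rightarrow> 'a \<Rightarrow> 'a set set" where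
  "star_edges V v = (\<lambda>w. {v, w}) ` (V - {v})"

lemma star_edges_subset: "v \<in> V \<Longrightarrow> star_edges V v \<subseteq> [V]\<^bsup>2\<^esup>"
  by (auto simp: star_edges_def)

lemma card_star_edges:
  assumes "finite V" "v \<in> V"
  shows "card (star_edges V v) = card V - 1"
  using assms unfolding star_edges_def
  by (subst card_image) (auto simp: inj_on_def doubleton_eq_iff)

text \<open>The two stars share exactly the pair \<open>{u, v}\<close>. This overlap is the source
  of the correlation between two vertices being isolated.\<close>

lemma card_two_star_edges:
  assumes "finite V" "u \<in> V" "v \<in> V" "u \<noteq> v"
  shows "card (star_edges V u \<union> star_edges V v) + 1 = (card V - 1) + (card V - 1)"
proof -
  have "star_edges V u \<inter> star_edges V v = {{u, v}}"
    using assms by (auto simp: star_edges_def doubleton_eq_iff)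
  moreover have "finite (star_edges V u)" "finite (star_edges V v)"
    using assms by (auto simp: star_edges_def)
  ultimately show ?thesis
    using card_Un_Int[of "star_edges V u" "star_edges V v"] assms
    by (simp add: card_star_edges)
qed

lemma isolated_not_connected:
  assumes "G \<in> set_pmf (gnp n p)" "n \<ge> 2" "v < n" "edges G \<inter> star_edges {..<n} v = {}"
  shows "\<not> connected_graph G"
proof (rule not_connected_if_isolated)
  have V: "verts G = {..<n}" "edges G \<subseteq> [{..<n}]\<^bsup>2\<^esup>"
    using verts_gnp[OF assms(1)] simple_graph_gnp[OF assms(1)] by (auto simp: simple_graph_def)
  show "v \<in> verts G" using assms(3) V by simp
  \<comment> \<open>Since \<open>n \<ge> 2\<close>, there is a vertex other than \<open>v\<close>:
    0, unless that is \<open>v\<close> itself.\<close>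
  show "(if v = 0 then 1 else 0) \<in> verts G" "(if v = 0 then 1 else 0) \<noteq> v"
    using assms(2) V by auto
  fix e assume e: "e \<in> edges G"
  show "v \<notin> e"
  proof
    assume "v \<in> e"
    obtain x y where "e = {x, y}" "x < n" "y < n" "x \<noteq> y"
      using subsetD[OF V(2) e] by (auto simp: nsets_2_eq)
    then have "e \<in> star_edges {..<n} v"
      using \<open>v \<in> e\<close> by (auto simp: star_edges_def insert_commute)
    then show False using assms(4) e by blast
  qed
qed

text \<open>Second moment method for the number of isolated vertices.\<close>

lemma prob_connected_le:
  assumes "0 \<le> p" "p < 1" "n \<ge> 2"
  shows "measure_pmf.prob (gnp n p) {G. connected_graph G} \<le>
    1 / (real n * (1 - p) ^ (n - 1)) + p / (1 - p)"
proof -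
  let ?M = "gnp n p"
  let ?V = "{..<n}"
  let ?A = "\<lambda>v. {G :: nat graph. edges G \<inter> star_edges ?V v = {}}"
  \<comment> \<open>\<open>\<mu>\<close> is the probability that a given vertex is isolated;
    \<open>X\<close> counts the isolated vertices.\<close>
  define \<mu> where "\<mu> = (1 - p) ^ (n - 1)"
  define X :: "nat graph \<Rightarrow> real" where "X G = (\<Sum>v<n. indicator (?A v) G)" for G
  have \<mu>: "\<mu> > 0" using assms by (simp add: \<mu>_def)
  have n: "real n > 0" using assms by simp
  have P1: "measure_pmf.prob ?M (?A v) = \<mu>" if "v < n" for v
    using that assms prob_gnp_avoid[of p "star_edges ?V v" n]
    by (simp add: star_edges_subset card_star_edges \<mu>_def)
  have P2: "measure_pmf.prob ?M (?A u \<inter> ?A v) = \<mu>\<^sup>2 / (1 - p)" if "u < n" "v < n" "u \<noteq> v" for u v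
  proof -
    have "?A u \<inter> ?A v = {G. edges G \<inter> (star_edges ?V u \<union> star_edges ?V v) = {}}"
      by auto
    then have "measure_pmf.prob ?M (?A u \<inter> ?A v) = (1 - p) ^ card (star_edges ?V u \<union> star_edges ?V v)"
      using that assms by (simp add: prob_gnp_avoid star_edges_subset)
    \<comment> \<open>The union of the stars has 2 (n - 1) - 1 pairs; one more factor completes the
      square of \<open>\<mu>\<close>.\<close>
    also have "\<dots> * (1 - p) = \<mu>\<^sup>2"
      using card_two_star_edges[of ?V u v] that
      by (simp add: \<mu>_def power2_eq_square power_add[symmetric] power_Suc2[symmetric] del: power_Suc)
    finally show ?thesis using assms by (simp add: field_simps)
  qed
  have EX: "measure_pmf.expectation ?M X = real n * \<mu>"
    unfolding X_def by (subst Bochner_Integration.integral_sum) (auto simp: P1)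
  have "measure_pmf.expectation ?M (\<lambda>G. (X G)\<^sup>2) =
      (\<Sum>u<n. \<Sum>v<n. measure_pmf.prob ?M (?A u \<inter> ?A v))"
    unfolding X_def power2_eq_square sum_product
    by (simp add: Bochner_Integration.integral_sum indicator_inter_arith[symmetric])
  \<comment> \<open>The \<open>if\<close> accounts for the diagonal, where the probability is
    \<open>\<mu>\<close>, so that one summand bounds all pairs.\<close>
  also have "\<dots> \<le> (\<Sum>u<n. \<Sum>v<n. \<mu>\<^sup>2 / (1 - p) + (if u = v then \<mu> else 0))"
    using assms P1 P2 by (intro sum_mono) auto
  also have "\<dots> = (real n)\<^sup>2 * \<mu>\<^sup>2 / (1 - p) + real n * \<mu>"
    by (simp add: sum.distrib power2_eq_square distrib_left)
  finally have EX2: "measure_pmf.expectation ?M (\<lambda>G. (X G)\<^sup>2) \<le> \<dots>" .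
  have "measure_pmf.variance ?M X \<le> (real n)\<^sup>2 * \<mu>\<^sup>2 / (1 - p) + real n * \<mu> - (real n * \<mu>)\<^sup>2"
    using EX2 by (subst measure_pmf.variance_eq) (auto simp: EX)
  also have "\<dots> = (1 / (real n * \<mu>) + p / (1 - p)) * (real n * \<mu>)\<^sup>2"
    using assms \<mu> n by (simp add: field_simps power2_eq_square)
  finally have var: "measure_pmf.variance ?M X / (real n * \<mu>)\<^sup>2 \<le> 1 / (real n * \<mu>) + p / (1 - p)"
    using \<mu> n by (simp add: pos_divide_le_eq)
  \<comment> \<open>A connected graph has \<open>X G = 0\<close>, which deviates from the mean by
    the whole mean: a case for Chebyshev's inequality.\<close>
  have "measure_pmf.prob ?M {G. connected_graph G} \<le>
      measure_pmf.prob ?M {G \<in> space ?M. real n * \<mu> \<le> \<bar>X G - measure_pmf.expectation ?M X\<bar>}"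
  proof (intro measure_pmf.finite_measure_mono_AE AE_pmfI impI)
    fix G assume G: "G \<in> set_pmf ?M" "G \<in> {G. connected_graph G}"
    then have "G \<notin> ?A v" if "v < n" for v
      using isolated_not_connected[OF G(1) assms(3) that] G(2) by auto
    then have "X G = 0" by (simp add: X_def)
    then show "G \<in> {G \<in> space ?M. real n * \<mu> \<le> \<bar>X G - measure_pmf.expectation ?M X\<bar>}"
      using EX by simp
  qed simp
  also have "\<dots> \<le> measure_pmf.variance ?M X / (real n * \<mu>)\<^sup>2"
    using \<mu> n by (intro measure_pmf.Chebyshev_inequality) auto
  also note var
  finally show ?thesis by (simp add: \<mu>_def)
qed

section \<open>Threshold bounds\<close>

text \<open>There are two bad events: an uncrossed cut, or at most half the expected number of
  edges. Outside both, \<open>tmc G\<close> exceeds that half minus \<open>n\<close>, hence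
  \<open>a\<close>. The exponent 1/8 is 1/2 minus 3/4 of 1/2.\<close>

lemma prob_tmc_less:
  assumes "0 \<le> p" "p \<le> 1" "n > 0" "a + real n \<le> real (n choose 2) * p / 2"
  shows "measure_pmf.prob (gnp n p) {G. real (tmc G) < a} \<le>
    (1 + exp (- p * real n / 2)) ^ n - 1 + exp (- (real (n choose 2) * p / 8))"
proof -
  let ?b = "real (n choose 2) * p / 2"
  let ?E = "{G. \<not> every_cut_crossed G}" and ?F = "{G. real (card (edges G)) \<le> ?b}"
  have "measure_pmf.prob (gnp n p) {G. real (tmc G) < a} \<le> measure_pmf.prob (gnp n p) (?E \<union> ?F)"
  proof (intro measure_pmf.finite_measure_mono_AE AE_pmfI impI)
    fix G assume G: "G \<in> set_pmf (gnp n p)" "G \<in> {G. real (tmc G) < a}"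
    show "G \<in> ?E \<union> ?F"
    proof (rule ccontr)
      assume "G \<notin> ?E \<union> ?F"
      then have "card (edges G) < tmc G + card (verts G)" "?b < real (card (edges G))"
        using card_edges_less_tmc_plus_verts[OF simple_graph_gnp[OF G(1)]] assms(3)
        by (auto simp: verts_gnp[OF G(1)])
      then show False using G assms(4) by (simp add: verts_gnp[OF G(1)])
    qed
  qed simp
  also have "\<dots> \<le> measure_pmf.prob (gnp n p) ?E + measure_pmf.prob (gnp n p) ?F"
    by (intro measure_Un_le) auto
  also have "measure_pmf.prob (gnp n p) ?F \<le> exp (3 / 4 * ?b - real (n choose 2) * p / 2)"
    using assms by (intro prob_card_edges_le) auto
  also have "3 / 4 * ?b - real (n choose 2) * p / 2 = - (real (n choose 2) * p / 8)"
    by simp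
  finally show ?thesis
    using prob_not_every_cut_crossed[OF assms(1,2), of n] by simp
qed

lemma tmc_gnp_ge_1:
  assumes "p \<ge> 1" "n > 0" "G \<in> set_pmf (gnp n p)"
  shows "n + (n choose 2) \<le> tmc G"
  using tmc_complete_ge[of "{..<n}"] assms(2)
  by (simp add: gnp_ge_1_complete[OF assms(1,3)] lessThan_empty_iff)

lemma real_choose_2: "real (n choose 2) = real n * (real n - 1) / 2"
  by (induction n) (auto simp: numeral_2_eq_2 field_simps)

lemma almost_surely_gnpI:
  assumes "\<forall>\<^sub>F n in sequentially. measure_pmf.prob (gnp n (p n)) {G. \<not> P n G} \<le> e n"
    and "e \<longlonglongrightarrow> 0"
  shows "almost_surely_gnp p P"
  unfolding almost_surely_gnp_def
proof (rule tendsto_sandwich)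
  have "measure_pmf.prob (gnp n (p n)) {G. \<not> P n G} =
      1 - measure_pmf.prob (gnp n (p n)) {G. P n G}" for n
    using measure_pmf.prob_compl[of "{G. P n G}" "gnp n (p n)"]
    by (simp add: Compl_eq_Diff_UNIV[symmetric] Collect_neg_eq)
  then show "\<forall>\<^sub>F n in sequentially. 1 - e n \<le> measure_pmf.prob (gnp n (p n)) {G. P n G}"
    using assms(1) by (auto elim!: eventually_mono)
  show "(\<lambda>n. 1 - e n) \<longlonglongrightarrow> 1"
    using tendsto_diff[OF tendsto_const assms(2), of 1] by simp
qed auto

text \<open>This serves both regimes. As \<open>p n\<close> may exceed 1, each \<open>n\<close> is
  treated separately: up to 1 \<open>prob_tmc_less\<close> applies, beyond it the graph is complete
  and the third assumption gives \<open>a n\<close>.\<close>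

lemma almost_surely_tmc_ge:
  assumes p: "\<forall>\<^sub>F n in sequentially. p n \<ge> 4 * ln (real n) / real n"
    and dense: "\<forall>\<^sub>F n in sequentially. a n + real n \<le> real (n choose 2) * p n / 2"
    and a: "\<forall>\<^sub>F n in sequentially. a n \<le> real n + real (n choose 2)"
  shows "almost_surely_gnp p (\<lambda>n G. real (tmc G) \<ge> a n)"
proof (rule almost_surely_gnpI)
  \<comment> \<open>The factor 4 makes \<open>exp (- p n * n / 2)\<close> at most n^(-2), and (1 +
    n^(-2))^n is at most exp (1/n). The last term bounds the edge tail.\<close>
  define e where "e n = exp (1 / real n) - 1 + exp (- ((real n - 1) * ln (real n) / 4))" for n
  show "e \<longlonglongrightarrow> 0"
    unfolding e_def by real_asymp
  show "\<forall>\<^sub>F n in sequentially. measure_pmf.prob (gnp n (p n)) {G. \<not> real (tmc G) \<ge> a n} \<le> e n"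
    using p dense a eventually_ge_at_top[of 2]
  proof eventually_elim
    case (elim n)
    then have n: "real n \<ge> 2" "n > 0" by auto
    have pos: "p n \<ge> 0"
      using elim(1) n by (smt (verit) divide_nonneg_nonneg ln_ge_zero)
    show ?case
    proof (cases "p n \<le> 1")
      case True
      have "measure_pmf.prob (gnp n (p n)) {G. real (tmc G) < a n} \<le>
          (1 + exp (- p n * real n / 2)) ^ n - 1 + exp (- (real (n choose 2) * p n / 8))"
        using pos True n(2) elim(2) by (rule prob_tmc_less)
      also have "(1 + exp (- p n * real n / 2)) ^ n \<le> (1 + 1 / (real n)\<^sup>2) ^ n"
      proof -
        have "- p n * real n / 2 \<le> - (2 * ln (real n))"
          using elim(1) n by (simp add: field_simps)
        then have "exp (- p n * real n / 2) \<le> exp (- (2 * ln (real n)))"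
          by simp
        also have "\<dots> = 1 / (real n)\<^sup>2"
          using n by (simp add: exp_minus exp_double inverse_eq_divide)
        finally show ?thesis by (intro power_mono) (auto intro: add_nonneg_nonneg)
      qed
      also have "\<dots> \<le> exp (1 / (real n)\<^sup>2) ^ n"
        by (intro power_mono) auto
      also have "\<dots> = exp (1 / real n)"
        using n by (simp add: exp_of_nat_mult[symmetric] power2_eq_square)
      also have "exp (- (real (n choose 2) * p n / 8)) \<le> exp (- ((real n - 1) * ln (real n) / 4))"
      proof -
        have "(real n - 1) * ln (real n) / 4 = (real n - 1) * real n / 16 * (4 * ln (real n) / real n)"
          using n by simp
        also have "\<dots> \<le> (real n - 1) * real n / 16 * p n"
          using elim(1) n by (intro mult_left_mono) auto
        finally show ?thesis
          using n by (simp add: real_choose_2 mult_ac)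
      qed
      finally show ?thesis by (simp add: e_def not_le)
    next
      case False
      have "AE G in gnp n (p n). \<not> real (tmc G) < a n"
      proof (rule AE_pmfI)
        fix G assume "G \<in> set_pmf (gnp n (p n))"
        then have "n + (n choose 2) \<le> tmc G"
          using False n by (intro tmc_gnp_ge_1) auto
        then show "\<not> real (tmc G) < a n" using elim(3) by linarith
      qed
      then have "measure_pmf.prob (gnp n (p n)) {G. real (tmc G) < a n} = 0"
        by (simp add: measure_pmf.prob_eq_0)
      moreover have "e n \<ge> 0"
        using n by (simp add: e_def)
      ultimately show ?thesis by (simp add: not_le)
    qed
  qed
qed

text \<open>A converse to 1 - p \<le> exp (- p), from (1 - p) (1 + 2 p) \<ge> 1 on [0, 1/2].\<close>

lemma one_minus_ge_exp:
  fixes p :: real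
  assumes "0 \<le> p" "p \<le> 1 / 2"
  shows "exp (- 2 * p) \<le> 1 - p"
proof -
  have "0 \<le> p * (1 - 2 * p)" using assms by simp
  then have "1 \<le> (1 - p) * (1 + 2 * p)" by (simp add: algebra_simps)
  also have "\<dots> \<le> (1 - p) * exp (2 * p)"
    using assms exp_ge_add_one_self[of "2 * p"] by (intro mult_left_mono) auto
  finally show ?thesis by (simp add: exp_minus field_simps)
qed

text \<open>At this density (1 - p)^n is eventually at least n^(-1/2), so the expected number of
  isolated vertices is at least the square root of n and the second moment bound tends to 0.\<close>

lemma almost_surely_not_connected:
  "almost_surely_gnp (\<lambda>n. 1 / 4 * (ln (real n) / real n)) (\<lambda>n G. \<not> connected_graph G)"
proof (rule almost_surely_gnpI)
  define p where "p n = 1 / 4 * (ln (real n) / real n)" for n :: nat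
  define e where "e n = 1 / (real n * exp (- (ln (real n) / 2))) + p n / (1 - p n)" for n
  show "e \<longlonglongrightarrow> 0"
    unfolding e_def p_def by real_asymp
  have "\<forall>\<^sub>F n in sequentially. p n \<le> 1 / 2"
    unfolding p_def by real_asymp
  then have "\<forall>\<^sub>F n in sequentially. measure_pmf.prob (gnp n (p n)) {G. connected_graph G} \<le> e n"
    using eventually_ge_at_top[of 2]
  proof eventually_elim
    case (elim n)
    then have n: "real n \<ge> 2" by simp
    have pos: "0 \<le> p n" using n by (simp add: p_def)
    have "exp (- (ln (real n) / 2)) = exp (- 2 * p n) ^ n"
      using n by (simp add: p_def exp_of_nat_mult[symmetric])
    also have "\<dots> \<le> (1 - p n) ^ n"
      using one_minus_ge_exp[OF pos elim(1)] by (intro power_mono) auto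
    also have "\<dots> \<le> (1 - p n) ^ (n - 1)"
      using pos elim(1) by (intro power_decreasing) auto
    finally have "1 / (real n * (1 - p n) ^ (n - 1)) \<le> 1 / (real n * exp (- (ln (real n) / 2)))"
      using n by (intro divide_left_mono mult_left_mono mult_pos_pos)
        (use elim(1) in auto)
    moreover have "measure_pmf.prob (gnp n (p n)) {G. connected_graph G} \<le>
        1 / (real n * (1 - p n) ^ (n - 1)) + p n / (1 - p n)"
      using pos elim by (intro prob_connected_le) auto
    ultimately show ?case by (simp add: e_def)
  qed
  then show "\<forall>\<^sub>F n in sequentially. measure_pmf.prob (gnp n (1 / 4 * (ln (real n) / real n)))
      {G. \<not> \<not> connected_graph G} \<le> e n"
    by (simp add: p_def)
qed

text \<open>Eventually \<open>n * ln (ln n)\<close> lies between 0 and \<open>f n\<close>, so the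
  threshold function lies between f n / n^2 and twice that. Comparing \<open>f n\<close> with the
  expected number of edges then decides.\<close>

lemma sharp_threshold_dense:
  fixes f :: "nat \<Rightarrow> real"
  assumes l: "l > 0" "\<And>n. n \<ge> 2 \<Longrightarrow> l * real n * ln (real n) \<le> f n"
    and f_le: "\<forall>\<^sub>F n in sequentially. f n \<le> real n + real (n choose 2)"
  shows "sharp_threshold (\<lambda>n. (f n + real n * ln (ln (real n))) / (real n)\<^sup>2)
    (\<lambda>n G. real (tmc G) \<ge> f n)"
proof -
  define g where "g n = (f n + real n * ln (ln (real n))) / (real n)\<^sup>2" for n
  \<comment> \<open>The last conjunct yields \<open>2 * n \<le> f n\<close>, which absorbs the
    vertex term on both sides of the threshold.\<close>
  have ev: "\<forall>\<^sub>F n in sequentially. n \<ge> 2 \<and> ln (ln (real n)) \<ge> 0 \<and>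
      ln (ln (real n)) \<le> l * ln (real n) \<and> l * ln (real n) \<ge> 2"
    using l(1) by (intro eventually_conj) real_asymp+
  have g: "\<forall>\<^sub>F n in sequentially. f n / (real n)\<^sup>2 \<le> g n \<and> g n \<le> 2 * f n / (real n)\<^sup>2 \<and>
      2 * real n \<le> f n"
    using ev
  proof eventually_elim
    case (elim n)
    have f: "l * real n * ln (real n) \<le> f n" using l(2) elim by simp
    have "real n * ln (ln (real n)) \<le> real n * (l * ln (real n))"
      using elim by (intro mult_left_mono) auto
    moreover have "real n * 2 \<le> real n * (l * ln (real n))"
      using elim by (intro mult_left_mono) auto
    ultimately have "real n * ln (ln (real n)) \<le> f n" "2 * real n \<le> f n"
      using f by (simp_all only: mult_ac)
    then show ?case
      using elim unfolding g_def by (auto intro!: divide_right_mono)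
  qed
  \<comment> \<open>The value 4/l lifts \<open>p n\<close> to \<open>4 * ln n / n\<close>, as the
    cuts require. The value 16 covers \<open>f n + n\<close>, at most \<open>2 * f n\<close>, by
    half the expected number of edges, which is at least n^2 / 8 times \<open>p n\<close>.\<close>
  define C where "C = max 16 (4 / l)"
  have "almost_surely_gnp p (\<lambda>n G. real (tmc G) \<ge> f n)"
    if p: "\<forall>\<^sub>F n in sequentially. p n \<ge> C * g n" for p
  proof (rule almost_surely_tmc_ge[OF _ _ f_le])
    have C: "C \<ge> 16" "C \<ge> 4 / l" "C \<ge> 0" by (auto simp: C_def)
    have p': "\<forall>\<^sub>F n in sequentially. p n \<ge> C * (f n / (real n)\<^sup>2) \<and> n \<ge> 2 \<and> 2 * real n \<le> f n"
      using p g eventually_ge_at_top[of 2]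
    proof eventually_elim
      case (elim n)
      then have "C * (f n / (real n)\<^sup>2) \<le> C * g n"
        using C(3) by (intro mult_left_mono) auto
      with elim show ?case by simp
    qed
    show "\<forall>\<^sub>F n in sequentially. p n \<ge> 4 * ln (real n) / real n"
      using p'
    proof eventually_elim
      case (elim n)
      have "4 * ln (real n) / real n = 4 / l * (l * real n * ln (real n) / (real n)\<^sup>2)"
        using l(1) elim by (simp add: power2_eq_square)
      also have "\<dots> \<le> C * (f n / (real n)\<^sup>2)"
        using C l elim by (intro mult_mono divide_right_mono) auto
      finally show ?case using elim by simp
    qed
    show "\<forall>\<^sub>F n in sequentially. f n + real n \<le> real (n choose 2) * p n / 2"
      using p'
    proof eventually_elim
      case (elim n)
      have n: "real n \<ge> 2" using elim by simp
      have "f n + real n \<le> (real n)\<^sup>2 / 8 * (16 * (f n / (real n)\<^sup>2))"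
        using elim by (simp add: power2_eq_square)
      also have "\<dots> \<le> (real n)\<^sup>2 / 8 * (C * (f n / (real n)\<^sup>2))"
        using C(1) elim by (intro mult_left_mono mult_right_mono) auto
      also have "\<dots> \<le> (real n)\<^sup>2 / 8 * p n"
        using elim by (intro mult_left_mono) auto
      also have "\<dots> \<le> real (n choose 2) / 2 * p n"
      proof (rule mult_right_mono)
        have "real n * 2 \<le> real n * real n" using n by (intro mult_left_mono) auto
        then show "(real n)\<^sup>2 / 8 \<le> real (n choose 2) / 2"
          by (simp add: real_choose_2 power2_eq_square field_simps)
        have "0 \<le> C * (f n / (real n)\<^sup>2)"
          using C elim by (intro mult_nonneg_nonneg divide_nonneg_nonneg) auto
        then show "0 \<le> p n" using elim by linarith
      qed
      finally show ?case by simp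
    qed
  qed
  \<comment> \<open>With 1/8 the expected number of edges is at most f n / 8, whereas
    \<open>tmc G \<ge> f n\<close> forces at least f n - n \<ge> f n / 2 edges.\<close>
  moreover have "almost_surely_gnp (\<lambda>n. 1 / 8 * g n) (\<lambda>n G. \<not> real (tmc G) \<ge> f n)"
  proof (rule almost_surely_gnpI)
    show "(\<lambda>n. exp (- (l * real n * ln (real n) / 8))) \<longlonglongrightarrow> 0"
      using l(1) by real_asymp
    show "\<forall>\<^sub>F n in sequentially. measure_pmf.prob (gnp n (1 / 8 * g n))
        {G. \<not> \<not> real (tmc G) \<ge> f n} \<le> exp (- (l * real n * ln (real n) / 8))"
      using g f_le eventually_ge_at_top[of 2]
    proof eventually_elim
      case (elim n)
      define p where "p = 1 / 8 * g n"
      have n: "real n \<ge> 2" using elim by simp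
      have p_le: "p \<le> f n / (4 * (real n)\<^sup>2)" using elim by (simp add: p_def)
      have "0 \<le> f n / (real n)\<^sup>2"
        using elim by (intro divide_nonneg_nonneg) auto
      then have p0: "0 \<le> p" using elim unfolding p_def by linarith
      have "real n * 2 \<le> real n * real n" using n by (intro mult_left_mono) auto
      \<comment> \<open>The upper bound on \<open>f\<close> keeps the edge probability at most 1, as
        the tail bound demands.\<close>
      then have "f n \<le> 4 * (real n)\<^sup>2"
        using elim(2) by (simp add: real_choose_2 power2_eq_square field_simps)
      then have "f n / (4 * (real n)\<^sup>2) \<le> 1"
        using n by (simp add: divide_le_eq)
      then have p1: "p \<le> 1" using p_le by linarith
      have "real (n choose 2) * p \<le> (real n)\<^sup>2 / 2 * p"
        using p0 by (intro mult_right_mono) (auto simp: real_choose_2 power2_eq_square field_simps)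
      also have "\<dots> \<le> (real n)\<^sup>2 / 2 * (f n / (4 * (real n)\<^sup>2))"
        using p_le by (intro mult_left_mono) auto
      also have "\<dots> = f n / 8" using n by simp
      finally have Np: "real (n choose 2) * p \<le> f n / 8" .
      have "measure_pmf.prob (gnp n p) {G. real (tmc G) \<ge> f n} \<le>
          measure_pmf.prob (gnp n p) {G. real (card (edges G)) \<ge> f n - real n}"
      proof (intro measure_pmf.finite_measure_mono_AE AE_pmfI impI)
        fix G assume "G \<in> set_pmf (gnp n p)" "G \<in> {G. real (tmc G) \<ge> f n}"
        then show "G \<in> {G. real (card (edges G)) \<ge> f n - real n}"
          using tmc_le_card_verts_edges[OF simple_graph_gnp[of G n p]] verts_gnp[of G n p]
          by simp
      qed simp
      also have "\<dots> \<le> exp (real (n choose 2) * p - (f n - real n) / 2)"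
        using p0 p1 elim by (intro prob_card_edges_ge) auto
      also have "real (n choose 2) * p - (f n - real n) / 2 \<le> - (l * real n * ln (real n) / 8)"
        using Np elim(1) l(2)[OF elim(3)] by argo
      finally show ?case by (simp add: p_def)
    qed
  qed
  ultimately show ?thesis
    unfolding sharp_threshold_def g_def
    by (intro exI[of _ C] exI[of _ "1 / 8"]) (auto simp: C_def)
qed

text \<open>Above the threshold the number of edges, of order at least n ln n, outgrows
  \<open>f\<close>; below it the graph is disconnected, so \<open>tmc\<close> is 0 while
  \<open>f n\<close> is at least 1.\<close>

lemma sharp_threshold_sparse:
  fixes f :: "nat \<Rightarrow> real"
  assumes f: "f \<in> o(\<lambda>n. real n * ln (real n))"
    and f_ge_1: "\<forall>\<^sub>F n in sequentially. 1 \<le> f n"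
    and f_le: "\<forall>\<^sub>F n in sequentially. f n \<le> real n + real (n choose 2)"
  shows "sharp_threshold (\<lambda>n. ln (real n) / real n) (\<lambda>n G. real (tmc G) \<ge> f n)"
proof -
  have "almost_surely_gnp p (\<lambda>n G. real (tmc G) \<ge> f n)"
    \<comment> \<open>The cuts ask for the factor 4. With 8, half the expected number of edges is at
      least 2 (n - 1) ln n \<ge> n ln n, which covers \<open>f n + n\<close>.\<close>
    if p: "\<forall>\<^sub>F n in sequentially. p n \<ge> 8 * (ln (real n) / real n)" for p
  proof (rule almost_surely_tmc_ge[OF _ _ f_le])
    show "\<forall>\<^sub>F n in sequentially. p n \<ge> 4 * ln (real n) / real n"
      using p eventually_ge_at_top[of 2]
    proof eventually_elim
      case (elim n)
      then have "0 \<le> ln (real n) / real n" by simp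
      with elim(1) have "4 * (ln (real n) / real n) \<le> p n" by linarith
      then show ?case by simp
    qed
    have "\<forall>\<^sub>F n in sequentially. norm (f n) \<le> 1 / 2 * norm (real n * ln (real n))"
      using landau_o.smallD[OF f, of "1 / 2"] by simp
    moreover have "\<forall>\<^sub>F n in sequentially. n \<ge> 2 \<and> ln (real n) \<ge> 2"
      by (intro eventually_conj) real_asymp+
    ultimately show "\<forall>\<^sub>F n in sequentially. f n + real n \<le> real (n choose 2) * p n / 2"
      using p
    proof eventually_elim
      case (elim n)
      then have n: "real n \<ge> 2" "ln (real n) \<ge> 2" by auto
      have "real n * 2 \<le> real n * ln (real n)"
        using n by (intro mult_left_mono) auto
      moreover have "f n \<le> 1 / 2 * (real n * ln (real n))"
        using elim(1) n by simp
      ultimately have "f n + real n \<le> real n * ln (real n)"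
        by linarith
      also have "\<dots> \<le> 2 * (real n - 1) * ln (real n)"
        using n by (intro mult_right_mono) auto
      also have "\<dots> = real (n choose 2) / 2 * (8 * (ln (real n) / real n))"
        using n by (simp add: real_choose_2)
      also have "\<dots> \<le> real (n choose 2) / 2 * p n"
        using elim(3) by (intro mult_left_mono) auto
      finally show ?case by simp
    qed
  qed
  moreover have "almost_surely_gnp (\<lambda>n. 1 / 4 * (ln (real n) / real n))
      (\<lambda>n G. \<not> real (tmc G) \<ge> f n)"
    unfolding almost_surely_gnp_def
  proof (rule tendsto_sandwich)
    show "(\<lambda>n. measure_pmf.prob (gnp n (1 / 4 * (ln (real n) / real n)))
        {G. \<not> connected_graph G}) \<longlonglongrightarrow> 1"
      using almost_surely_not_connected by (simp add: almost_surely_gnp_def)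
    show "\<forall>\<^sub>F n in sequentially.
        measure_pmf.prob (gnp n (1 / 4 * (ln (real n) / real n))) {G. \<not> connected_graph G} \<le>
        measure_pmf.prob (gnp n (1 / 4 * (ln (real n) / real n))) {G. \<not> real (tmc G) \<ge> f n}"
      using f_ge_1
    proof eventually_elim
      case (elim n)
      then show ?case
        by (intro measure_pmf.finite_measure_mono) (auto simp: tmc_def)
    qed
  qed auto
  ultimately show ?thesis
    unfolding sharp_threshold_def
    by (intro exI[of _ 8] exI[of _ "1 / 4"]) auto
qed

text \<open>The bounds on \<open>f\<close> start at 2 because for n \<le> 1 no number satisfies both
  inequalities of the range.\<close>

theorem theorem10:
  fixes f :: "nat \<Rightarrow> real"
  assumes f_range: "\<And>n. n \<ge> 2 \<Longrightarrow> 1 \<le> f n \<and> f n < 1 / 2 * real n * (real n - 1) + real n"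
  shows "((\<exists>l>0. \<forall>n\<ge>2. l * real n * ln (real n) \<le> f n) \<longrightarrow>
            sharp_threshold (\<lambda>n. (f n + real n * ln (ln (real n))) / (real n)\<^sup>2)
              (\<lambda>n G. real (tmc G) \<ge> f n)) \<and>
         (f \<in> o(\<lambda>n. real n * ln (real n)) \<longrightarrow>
            sharp_threshold (\<lambda>n. ln (real n) / real n)
              (\<lambda>n G. real (tmc G) \<ge> f n))"
proof -
  have f_le: "\<forall>\<^sub>F n in sequentially. f n \<le> real n + real (n choose 2)"
    using eventually_ge_at_top[of 2]
  proof eventually_elim
    case (elim n)
    then show ?case using f_range[of n] by (simp add: real_choose_2)
  qed
  have "\<forall>\<^sub>F n in sequentially. 1 \<le> f n"
    using eventually_ge_at_top[of 2] by eventually_elim (use f_range in blast)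
  then show ?thesis
    using sharp_threshold_dense[of _ f] sharp_threshold_sparse[of f] f_le by blast
qed

end
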